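(* Let $n\ge 1$ be an integer and let $m=2n+1$ agents $1,\dots,m$ be arranged in a ring network, agent $i$ having initial value $x_i(0)\in\mathbb{R}$. Let $\alpha_k=\frac{k}{k+1}$ for $1\le k<m$ and $\alpha_m=\frac12$. Suppose each agent $i$ maintains two estimates $x_{ia}(k),x_{ib}(k)$, initialized as $x_{ia}(1)=x_{ib}(1)=x_i(0)$ and updated synchronously for $k=2,\dots,m$ as follows, for all $i\in\{1,\dots,m\}$: (exchange iterations) if $k$ is even, $$x_{ia}(k)=(1-\alpha_k)x_{ia}(k-1)+\alpha_k\,x_{\mathrm{Pre}(i)\,b}(k-1),$$ $$x_{ib}(k)=(1-\alpha_k)x_{ib}(k-1)+\alpha_k\,x_{\mathrm{Post}(i)\,a}(k-1);$$ (local iterations, involving no communication) if $k$ is odd, $$x_{ia}(k)=(1-\alpha_k)x_{ia}(k-1)+\alpha_k x_{ib}(k-1),$$ $$x_{ib}(k)=(1-\alpha_k)x_{ib}(k-1)+\alpha_k x_{ia}(k-1).$$ Then: (i) every agent obtains the average: $x_{ia}(m)=\frac1m\sum_{j=1}^m x_j(0)$ for all $i=1,\dots,m$; (ii) the algorithm can be executed under the gossip constraint using $3n$ communication rounds in total: there are exactly $n$ exchange iterations, and for any partition of the edges of the ring into three classes such that no two distinct edges in the same class share a vertex (such partitions exist), each exchange iteration can be carried out in three successive communication rounds by activating the three classes of edges one after the other.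
   Context: The ring network with $m$ agents is the undirected cycle graph on vertex set $\{1,\dots,m\}$ with edges $(i,i+1)$ for $1\le i\le m-1$ and $(1,m)$. The successor and predecessor functions are $\mathrm{Post}(i)=i+1$ for $1\le i\le m-1$, $\mathrm{Post}(m)=1$; $\mathrm{Pre}(1)=m$, $\mathrm{Pre}(i)=i-1$ for $2\le i\le m$. Communication takes place in rounds. In each round a set of edges is activated, and the two endpoints of each active edge exchange information; the gossip constraint requires that, in each round, no two distinct active edges share a vertex (each agent communicates with at most one neighbor per round). When edge $(i,\mathrm{Post}(i))$ is activated during exchange iteration $k$, agents $i$ and $\mathrm{Post}(i)$ exchange $x_{ib}(k-1)$ and $x_{\mathrm{Post}(i)\,a}(k-1)$ and compute $x_{ib}(k)$ and $x_{\mathrm{Post}(i)\,a}(k)$ by the update formulas. The local iterations use only an agent's own two estimates and require no communication round. *)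

theory Defs
  imports Complex_Main "HOL-Library.Disjoint_Sets"
begin

text \<open>Agents are the naturals \<open>1, \<dots>, m\<close>; values of the functions below outside this range are
  irrelevant. An edge of the ring is the two-element set of its endpoints.\<close>

definition Post :: "nat \<Rightarrow> nat \<Rightarrow> nat" where
  "Post m i = (if i = m then 1 else i + 1)"

definition Pre :: "nat \<Rightarrow> nat \<Rightarrow> nat" where
  "Pre m i = (if i = 1 then m else i - 1)"

definition ring_edges :: "nat \<Rightarrow> nat set set" where
  "ring_edges m = {{i, i + 1} | i. 1 \<le> i \<and> i \<le> m - 1} \<union> {{1, m}}"

definition gossip_constraint :: "nat set set \<Rightarrow> bool" where
  "gossip_constraint C \<longleftrightarrow> pairwise disjnt C"

text \<open>The classes are given as a list, to record the order in which they are activated.\<close>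

definition gossip_partition :: "nat \<Rightarrow> nat set set list \<Rightarrow> bool" where
  "gossip_partition m Cs \<longleftrightarrow>
     length Cs = 3 \<and> distinct Cs \<and> partition_on (ring_edges m) (set Cs) \<and>
     (\<forall>C\<in>set Cs. gossip_constraint C)"

definition alpha :: "nat \<Rightarrow> nat \<Rightarrow> real" where
  "alpha m k = (if k = m then 1 / 2 else real k / (real k + 1))"

text \<open>A state holds the current \<open>a\<close>-estimates and \<open>b\<close>-estimates of all agents.\<close>

type_synonym estimates = "(nat \<Rightarrow> real) \<times> (nat \<Rightarrow> real)"

text \<open>One communication round of exchange iteration \<open>k\<close>, with active edge set \<open>C\<close>: an active edge
  between \<open>i\<close> and its successor overwrites \<open>i\<close>'s \<open>b\<close>-estimate and the successor's \<open>a\<close>-estimate, and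
  every estimate not served by an active edge keeps its current value.\<close>

definition activate :: "nat \<Rightarrow> nat \<Rightarrow> nat set set \<Rightarrow> estimates \<Rightarrow> estimates" where
  "activate m k C = (\<lambda>(a, b).
     ((\<lambda>i. if {Pre m i, i} \<in> C then (1 - alpha m k) * a i + alpha m k * b (Pre m i) else a i),
      (\<lambda>i. if {i, Post m i} \<in> C then (1 - alpha m k) * b i + alpha m k * a (Post m i) else b i)))"

definition local_update :: "nat \<Rightarrow> nat \<Rightarrow> estimates \<Rightarrow> estimates" where
  "local_update m k = (\<lambda>(a, b).
     ((\<lambda>i. (1 - alpha m k) * a i + alpha m k * b i),
      (\<lambda>i. (1 - alpha m k) * b i + alpha m k * a i)))"

text \<open>Each action carries the iteration \<open>k\<close> it belongs to; only a \<open>Round\<close> communicates.\<close>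

datatype action = is_Round: Round nat "nat set set" | Local nat

fun perform :: "nat \<Rightarrow> action \<Rightarrow> estimates \<Rightarrow> estimates" where
  "perform m (Round k C) = activate m k C"
| "perform m (Local k) = local_update m k"

definition execute :: "nat \<Rightarrow> action list \<Rightarrow> estimates \<Rightarrow> estimates" where
  "execute m acts = fold (perform m) acts"

definition num_rounds :: "action list \<Rightarrow> nat" where
  "num_rounds acts = length (filter is_Round acts)"

definition gossip_compliant :: "nat \<Rightarrow> action list \<Rightarrow> bool" where
  "gossip_compliant m acts \<longleftrightarrow>
     (\<forall>k C. Round k C \<in> set acts \<longrightarrow> C \<subseteq> ring_edges m \<and> gossip_constraint C)"

definition iteration_actions :: "nat set set list \<Rightarrow> nat \<Rightarrow> action list" where
  "iteration_actions Cs k = (if even k then map (Round k) Cs else [Local k])"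

text \<open>The actions of iterations \<open>2, \<dots>, K\<close>.\<close>

definition schedule :: "nat set set list \<Rightarrow> nat \<Rightarrow> action list" where
  "schedule Cs K = concat (map (iteration_actions Cs) [2..<Suc K])"

definition agree_on_agents :: "nat \<Rightarrow> estimates \<Rightarrow> estimates \<Rightarrow> bool" where
  "agree_on_agents m s t \<longleftrightarrow> (\<forall>i\<in>{1..m}. fst s i = fst t i \<and> snd s i = snd t i)"

end

theory Submission
  imports Defs
begin

text \<open>Before the final iteration the estimates of agent \<open>i\<close> are averages of the values in a window
  around \<open>i\<close> on the ring whose weights are affine in the signed distance to \<open>i\<close>, with opposite
  slopes for the \<open>a\<close>- and the \<open>b\<close>-estimate: an exchange iteration extends the window and a local
  one swaps the two slopes. At \<open>k = 2 n\<close> the windows cover the ring and the two weight profiles add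
  up to a constant, so the final mean of the two estimates is the average of all values.

  The estimates \<open>x\<^sub>i\<^sub>b\<close> and \<open>x\<^bsub>Post(i)a\<^esub>\<close> that an edge updates are read and written by no other
  edge in the same exchange iteration, so the order of activation is irrelevant.\<close>

section \<open>Affine weights on symmetric windows\<close>

text \<open>The index \<open>s\<close> is a signed offset from the centre. Letting \<open>Y\<close>
  live on all integers makes passing to a neighbour's window a shift of \<open>Y\<close> and
  changing the sign of the slope a reflection. The slopes cancel in the total weight, which is
  \<open>c * (2 * p + 1)\<close>; this is the denominator used throughout.\<close>

definition window_sum :: "nat \<Rightarrow> real \<Rightarrow> real \<Rightarrow> (int \<Rightarrow> real) \<Rightarrow> real" where
  "window_sum p c d Y = (\<Sum>s=-int p..int p. (c + d * of_int s) * Y s)"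

lemma window_sum_combine:
  "u * window_sum p c d Y + v * window_sum p c' d' Y
     = window_sum p (u * c + v * c') (u * d + v * d') Y"
  unfolding window_sum_def sum_distrib_left sum.distrib[symmetric]
  by (rule sum.cong) (auto simp: algebra_simps)

lemma window_sum_scale: "u * window_sum p c d Y = window_sum p (u * c) (u * d) Y"
  unfolding window_sum_def sum_distrib_left by (rule sum.cong) (auto simp: algebra_simps)

lemma window_sum_reflect: "window_sum p c (- d) Y = window_sum p c d (\<lambda>s. Y (- s))"
  unfolding window_sum_def
  by (rule sum.reindex_bij_witness[of _ uminus uminus]) auto

lemma weighted_sum_divide:
  "(1 / c) * (x / d) + (e / c) * (y / d) = (x + e * y) / (c * d)" for c d e x y :: real
  by (simp add: add_divide_distrib)

text \<open>The coefficients are \<open>1 - alpha m k\<close> and \<open>alpha m k\<close> at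
  \<open>k = 2 * p + 1 < m\<close>. The constants combine to \<open>2 * p * (p + 1)\<close> and the
  slopes to \<open>2 * p * d\<close>. The common factor \<open>2 * p\<close>, nonzero by assumption,
  then cancels.\<close>

lemma window_sum_local:
  assumes "p \<ge> 1"
  shows "(1 / (2 * real p + 2)) * (window_sum p p (- d) Y / (p * (2 * p + 1)))
       + ((2 * real p + 1) / (2 * real p + 2)) * (window_sum p p d Y / (p * (2 * p + 1)))
     = window_sum p (p + 1) d Y / ((p + 1) * (2 * p + 1))"
proof -
  have "(1 / (2 * real p + 2)) * (window_sum p p (- d) Y / (p * (2 * p + 1)))
       + ((2 * real p + 1) / (2 * real p + 2)) * (window_sum p p d Y / (p * (2 * p + 1)))
     = (1 * window_sum p p (- d) Y + (2 * real p + 1) * window_sum p p d Y)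
        / ((2 * real p + 2) * (p * (2 * p + 1)))"
    unfolding weighted_sum_divide by simp
  also have "1 * window_sum p p (- d) Y + (2 * real p + 1) * window_sum p p d Y
     = (2 * real p) * window_sum p (p + 1) d Y"
    unfolding window_sum_combine unfolding window_sum_scale by (simp add: algebra_simps)
  also have "\<dots> / ((2 * real p + 2) * (p * (2 * p + 1)))
     = window_sum p (p + 1) d Y / ((p + 1) * (2 * p + 1))"
  proof -
    have "(2 * real p + 2) * (p * (2 * p + 1)) = (2 * real p) * ((p + 1) * (2 * p + 1))"
      by (simp add: algebra_simps)
    then show ?thesis using assms by simp
  qed
  finally show ?thesis .
qed

text \<open>Each weight profile vanishes at one end, so all three sums can be taken over the common
  interval from \<open>- p - 1\<close> to \<open>p\<close>. There the claim is pointwise: \<open>(p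
  + 1 + s) + (2 * p + 2) * (p - s) = (2 * p + 1) * (p + 1 - s)\<close>.\<close>

lemma window_sum_extend:
  "window_sum p (p + 1) 1 Y + (2 * real p + 2) * window_sum p (p + 1) (- 1) (\<lambda>s. Y (s - 1))
     = (2 * real p + 1) * window_sum (p + 1) (p + 1) (- 1) Y"
proof -
  let ?I = "{-int p - 1..int p}"
  have 1: "window_sum p (p + 1) 1 Y = (\<Sum>s\<in>?I. (real p + 1 + of_int s) * Y s)"
    unfolding window_sum_def
  proof (rule sum.mono_neutral_cong_left)
    show "\<forall>s\<in>?I - {- int p..int p}. (real p + 1 + of_int s) * Y s = 0"
    proof
      fix s assume "s \<in> ?I - {- int p..int p}"
      then have "s = - int p - 1" by auto
      then show "(real p + 1 + of_int s) * Y s = 0" by simp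
    qed
  qed auto
  have "window_sum p (p + 1) (- 1) (\<lambda>s. Y (s - 1))
      = (\<Sum>s=-int p - 1..int p - 1. (real p - of_int s) * Y s)"
    unfolding window_sum_def
    by (rule sum.reindex_bij_witness[of _ "\<lambda>s. s + 1" "\<lambda>s. s - 1"]) auto
  also have "\<dots> = (\<Sum>s\<in>?I. (real p - of_int s) * Y s)"
    by (rule sum.mono_neutral_cong_left) auto
  finally have 2: "window_sum p (p + 1) (- 1) (\<lambda>s. Y (s - 1)) = \<dots>" .
  have 3: "window_sum (p + 1) (p + 1) (- 1) Y = (\<Sum>s\<in>?I. (real p + 1 - of_int s) * Y s)"
    unfolding window_sum_def by (rule sum.mono_neutral_cong_right) auto
  show ?thesis
    unfolding 1 2 3 sum_distrib_left sum.distrib[symmetric]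
    by (rule sum.cong) (auto simp: algebra_simps)
qed

text \<open>The coefficients are \<open>1 - alpha m k\<close> and \<open>alpha m k\<close> at
  \<open>k = 2 * p + 2\<close>. Taking \<open>\<sigma> = 1\<close> serves the a-estimates, which
  hear from the predecessor; \<open>\<sigma> = - 1\<close> serves the b-estimates and is the mirror
  image of the first case.\<close>

lemma window_sum_exchange:
  assumes "\<sigma> = 1 \<or> \<sigma> = (- 1 :: int)"
  shows "(1 / (2 * real p + 3)) * (window_sum p (p + 1) \<sigma> Y / ((p + 1) * (2 * p + 1)))
       + ((2 * real p + 2) / (2 * real p + 3))
          * (window_sum p (p + 1) (- \<sigma>) (\<lambda>s. Y (s - \<sigma>)) / ((p + 1) * (2 * p + 1)))
     = window_sum (p + 1) (p + 1) (- \<sigma>) Y / ((p + 1) * (2 * (p + 1) + 1))"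
proof -
  have *: "window_sum p (p + 1) \<sigma> Y
        + (2 * real p + 2) * window_sum p (p + 1) (- \<sigma>) (\<lambda>s. Y (s - \<sigma>))
     = (2 * real p + 1) * window_sum (p + 1) (p + 1) (- \<sigma>) Y"
    using assms
  proof
    assume "\<sigma> = - 1"
    then show ?thesis
      using window_sum_extend[of p "\<lambda>s. Y (- s)"]
        window_sum_reflect[of p "p + 1" 1 Y]
        window_sum_reflect[of "p + 1" "p + 1" "- 1" Y]
        window_sum_reflect[of p "p + 1" "- 1" "\<lambda>s. Y (s + 1)"]
      by simp
  qed (use window_sum_extend in simp)
  have "(1 / (2 * real p + 3)) * (window_sum p (p + 1) \<sigma> Y / ((p + 1) * (2 * p + 1)))
       + ((2 * real p + 2) / (2 * real p + 3))
          * (window_sum p (p + 1) (- \<sigma>) (\<lambda>s. Y (s - \<sigma>)) / ((p + 1) * (2 * p + 1)))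
     = (window_sum p (p + 1) \<sigma> Y
        + (2 * real p + 2) * window_sum p (p + 1) (- \<sigma>) (\<lambda>s. Y (s - \<sigma>)))
        / ((2 * real p + 3) * ((p + 1) * (2 * p + 1)))"
    by (rule weighted_sum_divide)
  also have "\<dots> = window_sum (p + 1) (p + 1) (- \<sigma>) Y / ((p + 1) * (2 * (p + 1) + 1))"
  proof -
    \<comment> \<open>The factor \<open>2 * p + 1\<close> from the extension identity cancels the
      one in the old total weight, leaving the total weight of the wider window.\<close>
    have "(2 * real p + 3) * ((p + 1) * (2 * p + 1))
        = (2 * real p + 1) * ((p + 1) * (2 * (p + 1) + 1))"
      by (simp add: algebra_simps)
    moreover have "2 * real p + 1 \<noteq> 0" by linarith
    ultimately show ?thesis unfolding * by simp
  qed
  finally show ?thesis .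
qed

section \<open>Unrolling the ring to the integers\<close>

text \<open>The shift by one before and after \<open>mod\<close> turns residues
  \<open>0, ..., m - 1\<close> into agent numbers \<open>1, ..., m\<close>.\<close>

definition periodic_ext :: "nat \<Rightarrow> (nat \<Rightarrow> real) \<Rightarrow> int \<Rightarrow> real" where
  "periodic_ext m x z = x (nat ((z - 1) mod int m) + 1)"

lemma periodic_ext_of_nat: "i \<in> {1..m} \<Longrightarrow> periodic_ext m x (int i) = x i"
  by (cases i) (auto simp: periodic_ext_def)

lemma periodic_ext_add: "periodic_ext m x (z + int m) = periodic_ext m x z"
proof -
  have "z + int m - 1 = (z - 1) + int m" by simp
  then show ?thesis unfolding periodic_ext_def by (simp only: mod_add_self2)
qed

text \<open>The wraparound at agent 1 is a translation by a full period, so no case distinction on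
  the ring remains.\<close>

lemma periodic_ext_Pre:
  "i \<in> {1..m} \<Longrightarrow> periodic_ext m x (int (Pre m i) + s) = periodic_ext m x (int i + (s - 1))"
  using periodic_ext_add[of m x s] by (auto simp: Pre_def of_nat_diff algebra_simps)

lemma periodic_ext_Post:
  "i \<in> {1..m} \<Longrightarrow> periodic_ext m x (int (Post m i) + s) = periodic_ext m x (int i + (s + 1))"
  using periodic_ext_add[of m x "s + 1"] by (auto simp: Post_def algebra_simps)

text \<open>A window of radius \<open>n\<close> has \<open>m\<close> consecutive points, hence meets
  every agent exactly once, whatever its centre.\<close>

lemma window_sum_periodic_ext:
  assumes "m = 2 * n + 1"
  shows "window_sum n c 0 (\<lambda>s. periodic_ext m x (int i + s)) = c * (\<Sum>j=1..m. x j)"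
proof -
  let ?f = "periodic_ext m x"
  \<comment> \<open>Moving the window by one drops its left end and adds a point exactly one period
    further on.\<close>
  have shift: "(\<Sum>z=int i - int n..int i + int n. ?f z) = (\<Sum>z=- int n..int n. ?f z)" for i
  proof (induction i)
    case (Suc i)
    have "{int i - int n..int i + int n} = insert (int i - int n) {int i - int n + 1..int i + int n}"
      "{int (Suc i) - int n..int (Suc i) + int n}
         = insert (int i + int n + 1) {int i - int n + 1..int i + int n}"
      by auto
    moreover have "?f (int i + int n + 1) = ?f (int i - int n)"
      using periodic_ext_add[of m x "int i - int n"] assms by (simp add: algebra_simps)
    ultimately show ?case using Suc by simp
  qed simp
  have "window_sum n c 0 (\<lambda>s. ?f (int i + s)) = c * (\<Sum>s=-int n..int n. ?f (int i + s))"
    by (simp add: window_sum_def sum_distrib_left)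
  also have "(\<Sum>s=-int n..int n. ?f (int i + s)) = (\<Sum>z=int i - int n..int i + int n. ?f z)"
    by (rule sum.reindex_bij_witness[of _ "\<lambda>z. z - int i" "\<lambda>s. int i + s"]) auto
  \<comment> \<open>Centred at \<open>n + 1\<close>, the window is \<open>1, ..., m\<close>
    itself.\<close>
  also have "\<dots> = (\<Sum>z=int (n + 1) - int n..int (n + 1) + int n. ?f z)"
    unfolding shift ..
  also have "\<dots> = (\<Sum>j=1..m. ?f (int j))"
    by (rule sum.reindex_bij_witness[of _ int nat]) (use assms in auto)
  also have "\<dots> = (\<Sum>j=1..m. x j)"
    by (rule sum.cong) (auto simp: periodic_ext_of_nat)
  finally show ?thesis .
qed

section \<open>Neighbours and edges of the ring\<close>

lemma Pre_in_agents: "i \<in> {1..m} \<Longrightarrow> Pre m i \<in> {1..m}"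
  by (auto simp: Pre_def)

lemma Post_in_agents: "i \<in> {1..m} \<Longrightarrow> Post m i \<in> {1..m}"
  by (auto simp: Post_def)

lemma Post_Pre: "i \<in> {1..m} \<Longrightarrow> Post m (Pre m i) = i"
  by (auto simp: Pre_def Post_def)

lemma Pre_Post: "i \<in> {1..m} \<Longrightarrow> Pre m (Post m i) = i"
  by (auto simp: Pre_def Post_def)

lemma Post_edge: "i \<in> {1..m} \<Longrightarrow> {i, Post m i} \<in> ring_edges m"
  by (auto simp: Post_def ring_edges_def)

lemma Pre_edge: "i \<in> {1..m} \<Longrightarrow> {Pre m i, i} \<in> ring_edges m"
  using Post_edge[OF Pre_in_agents] Post_Pre by metis

section \<open>Closed form of the estimates and the average\<close>

lemma estimates_closed_form:
  fixes x0 :: "nat \<Rightarrow> real" and xa xb :: "nat \<Rightarrow> nat \<Rightarrow> real"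
  assumes m: "m = 2 * n + 1"
    and init: "\<forall>i\<in>{1..m}. xa i 1 = x0 i \<and> xb i 1 = x0 i"
    and exch: "\<forall>k\<in>{2..m}. even k \<longrightarrow> (\<forall>i\<in>{1..m}.
           xa i k = (1 - alpha m k) * xa i (k - 1) + alpha m k * xb (Pre m i) (k - 1) \<and>
           xb i k = (1 - alpha m k) * xb i (k - 1) + alpha m k * xa (Post m i) (k - 1))"
    and loc: "\<forall>k\<in>{2..m}. odd k \<longrightarrow> (\<forall>i\<in>{1..m}.
           xa i k = (1 - alpha m k) * xa i (k - 1) + alpha m k * xb i (k - 1) \<and>
           xb i k = (1 - alpha m k) * xb i (k - 1) + alpha m k * xa i (k - 1))"
    and "p < n" "i \<in> {1..m}"
  shows "xa i (2 * p + 2) =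
      window_sum (p + 1) (p + 1) (- 1) (\<lambda>s. periodic_ext m x0 (int i + s))
        / ((p + 1) * (2 * (p + 1) + 1))"
    and "xb i (2 * p + 2) =
      window_sum (p + 1) (p + 1) 1 (\<lambda>s. periodic_ext m x0 (int i + s))
        / ((p + 1) * (2 * (p + 1) + 1))"
proof -
  let ?Y = "\<lambda>i s. periodic_ext m x0 (int i + s)"
  define even_form where "even_form p \<longleftrightarrow> (\<forall>i\<in>{1..m}.
      xa i (2 * p) = window_sum p p (- 1) (?Y i) / (p * (2 * p + 1)) \<and>
      xb i (2 * p) = window_sum p p 1 (?Y i) / (p * (2 * p + 1)))" for p
  define odd_form where "odd_form p \<longleftrightarrow> (\<forall>i\<in>{1..m}.
      xa i (2 * p + 1) = window_sum p (p + 1) 1 (?Y i) / ((p + 1) * (2 * p + 1)) \<and>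
      xb i (2 * p + 1) = window_sum p (p + 1) (- 1) (?Y i) / ((p + 1) * (2 * p + 1)))" for p
  have even_step: "even_form (p + 1)" if "odd_form p" "p < n" for p
    unfolding even_form_def
  proof
    fix i assume i: "i \<in> {1..m}"
    \<comment> \<open>Since \<open>m\<close> is odd, an exchange iteration never meets the
      exceptional value of \<open>alpha\<close> at \<open>m\<close>.\<close>
    have "2 * p + 2 \<noteq> m" using m by presburger
    then have al: "alpha m (2 * p + 2) = (2 * real p + 2) / (2 * real p + 3)"
      by (simp add: alpha_def add.commute)
    then have al': "1 - alpha m (2 * p + 2) = 1 / (2 * real p + 3)"
      by (simp add: field_simps)
    have "xa i (2 * p + 2) = (1 - alpha m (2 * p + 2)) * xa i (2 * p + 1)
          + alpha m (2 * p + 2) * xb (Pre m i) (2 * p + 1) \<and>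
        xb i (2 * p + 2) = (1 - alpha m (2 * p + 2)) * xb i (2 * p + 1)
          + alpha m (2 * p + 2) * xa (Post m i) (2 * p + 1)"
      using exch[rule_format, of "2 * p + 2" i] i \<open>p < n\<close> m by simp
    moreover have "?Y (Pre m i) = (\<lambda>s. ?Y i (s - 1))" "?Y (Post m i) = (\<lambda>s. ?Y i (s + 1))"
      using periodic_ext_Pre[OF i] periodic_ext_Post[OF i] by auto
    ultimately show "xa i (2 * (p + 1)) =
          window_sum (p + 1) (p + 1) (- 1) (?Y i) / ((p + 1) * (2 * (p + 1) + 1)) \<and>
        xb i (2 * (p + 1)) =
          window_sum (p + 1) (p + 1) 1 (?Y i) / ((p + 1) * (2 * (p + 1) + 1))"
      using window_sum_exchange[of 1 p "?Y i"] window_sum_exchange[of "- 1" p "?Y i"]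
        \<open>odd_form p\<close> i Pre_in_agents[OF i] Post_in_agents[OF i]
      unfolding odd_form_def al' unfolding al by (simp add: mult_ac)
  qed
  have odd_step: "odd_form p" if "even_form p" "p < n" "p \<ge> 1" for p
    unfolding odd_form_def
  proof
    fix i assume i: "i \<in> {1..m}"
    have "2 * p + 1 \<noteq> m" using m \<open>p < n\<close> by simp
    then have al: "alpha m (2 * p + 1) = (2 * real p + 1) / (2 * real p + 2)"
      by (simp add: alpha_def add.commute)
    then have al': "1 - alpha m (2 * p + 1) = 1 / (2 * real p + 2)"
      by (simp add: field_simps)
    have "xa i (2 * p + 1) = (1 - alpha m (2 * p + 1)) * xa i (2 * p)
          + alpha m (2 * p + 1) * xb i (2 * p) \<and>
        xb i (2 * p + 1) = (1 - alpha m (2 * p + 1)) * xb i (2 * p)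
          + alpha m (2 * p + 1) * xa i (2 * p)"
      using loc[rule_format, of "2 * p + 1" i] i \<open>p < n\<close> \<open>p \<ge> 1\<close> m by simp
    then show "xa i (2 * p + 1) = window_sum p (p + 1) 1 (?Y i) / ((p + 1) * (2 * p + 1)) \<and>
        xb i (2 * p + 1) = window_sum p (p + 1) (- 1) (?Y i) / ((p + 1) * (2 * p + 1))"
      using window_sum_local[OF \<open>p \<ge> 1\<close>, of 1 "?Y i"]
        window_sum_local[OF \<open>p \<ge> 1\<close>, of "- 1" "?Y i"] \<open>even_form p\<close> i
      unfolding even_form_def al' unfolding al by (simp add: mult_ac)
  qed
  \<comment> \<open>The start is iteration 1, with a one-point window of weight 1.
    \<open>even_form 0\<close> would refer to iteration 0 and to a vanishing total weight, so the
    chain cannot begin there.\<close>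
  have "odd_form 0"
    using init periodic_ext_of_nat[of _ m x0] by (simp add: odd_form_def window_sum_def)
  then have "p < n \<Longrightarrow> even_form (p + 1)" for p
    by (induction p) (use even_step odd_step in auto)
  then show "xa i (2 * p + 2) =
      window_sum (p + 1) (p + 1) (- 1) (?Y i) / ((p + 1) * (2 * (p + 1) + 1))"
    and "xb i (2 * p + 2) =
      window_sum (p + 1) (p + 1) 1 (?Y i) / ((p + 1) * (2 * (p + 1) + 1))"
    using \<open>p < n\<close> \<open>i \<in> {1..m}\<close> by (auto simp: even_form_def)
qed

lemma average_reached:
  fixes x0 :: "nat \<Rightarrow> real" and xa xb :: "nat \<Rightarrow> nat \<Rightarrow> real"
  assumes "n \<ge> 1" and m: "m = 2 * n + 1"
    and init: "\<forall>i\<in>{1..m}. xa i 1 = x0 i \<and> xb i 1 = x0 i"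
    and exch: "\<forall>k\<in>{2..m}. even k \<longrightarrow> (\<forall>i\<in>{1..m}.
           xa i k = (1 - alpha m k) * xa i (k - 1) + alpha m k * xb (Pre m i) (k - 1) \<and>
           xb i k = (1 - alpha m k) * xb i (k - 1) + alpha m k * xa (Post m i) (k - 1))"
    and loc: "\<forall>k\<in>{2..m}. odd k \<longrightarrow> (\<forall>i\<in>{1..m}.
           xa i k = (1 - alpha m k) * xa i (k - 1) + alpha m k * xb i (k - 1) \<and>
           xb i k = (1 - alpha m k) * xb i (k - 1) + alpha m k * xa i (k - 1))"
    and i: "i \<in> {1..m}"
  shows "xa i m = (1 / real m) * (\<Sum>j=1..m. x0 j)"
proof -
  let ?Y = "\<lambda>s. periodic_ext m x0 (int i + s)"
  obtain p where n: "n = p + 1" using \<open>n \<ge> 1\<close> by (metis add.commute le_Suc_ex)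
  \<comment> \<open>Iteration \<open>m\<close> is local, and here \<open>alpha\<close> takes its
    exceptional value.\<close>
  have "xa i m = (1 / 2) * xa i (2 * n) + (1 / 2) * xb i (2 * n)"
    using loc[rule_format, of m i] i m \<open>n \<ge> 1\<close> by (simp add: alpha_def)
  also have "\<dots> = ((1 / 2) * window_sum n n (- 1) ?Y + (1 / 2) * window_sum n n 1 ?Y)
      / (n * (2 * n + 1))"
    using estimates_closed_form[OF m init exch loc _ i, of p] n
    by (simp add: add_divide_distrib)
  \<comment> \<open>The opposite slopes cancel, leaving constant weight \<open>n\<close> on a window
    covering the ring.\<close>
  also have "\<dots> = window_sum n n 0 ?Y / (n * (2 * n + 1))"
    unfolding window_sum_combine by simp
  also have "\<dots> = window_sum n n 0 ?Y / (real n * real m)"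
    by (simp only: m of_nat_mult)
  also have "\<dots> = (1 / real m) * (\<Sum>j=1..m. x0 j)"
    unfolding window_sum_periodic_ext[OF m] using \<open>n \<ge> 1\<close> by simp
  finally show ?thesis .
qed

section \<open>Number of exchange iterations and a three-class partition\<close>

lemma card_even_iterations: "card {k\<in>{2..2 * n + 1}. even k} = n"
proof -
  have "{k\<in>{2..2 * n + 1}. even k} = (\<lambda>j. 2 * j) ` {1..n}"
    by (auto elim!: evenE)
  then show ?thesis by (simp add: card_image inj_on_def)
qed

text \<open>Consecutive edges are split by the parity of their smaller endpoint; the closing edge
  forms a class of its own.\<close>

lemma gossip_partition_exists:
  assumes "n \<ge> 1" and m: "m = 2 * n + 1"
  shows "\<exists>Cs. gossip_partition m Cs"
proof -
  define O1 where "O1 = {{i, i + 1} | i. i < m \<and> odd i}"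
  define E where "E = {{i, i + 1} | i. 1 \<le> i \<and> i < m \<and> even i}"
  define L where "L = {{1, m}}"
  \<comment> \<open>These edges exist because \<open>m \<ge> 3\<close>. Nonemptiness is part of
    being a partition and, with disjointness, makes the classes distinct.\<close>
  have ne: "{1, 1 + 1} \<in> O1" "{2, 2 + 1} \<in> E" "{1, m} \<in> L"
    using assms unfolding O1_def E_def L_def by fastforce+
  have "False" if "{i, i + 1} = {j, j + 1}" "odd i" "even j" for i j :: nat
    using that by (auto simp: doubleton_eq_iff)
  then have "disjnt O1 E"
    unfolding disjnt_def O1_def E_def by blast
  \<comment> \<open>As \<open>m \<ge> 3\<close>, the numbers \<open>1\<close> and \<open>m\<close>
    are not consecutive.\<close>
  moreover have "disjnt O1 L" "disjnt E L"
    using assms by (auto simp: O1_def E_def L_def disjnt_def doubleton_eq_iff)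
  ultimately have dis: "disjnt O1 E" "disjnt O1 L" "disjnt E L" by blast+
  \<comment> \<open>Distinct numbers of equal parity differ by at least two.\<close>
  have step: "disjnt {i, i + 1} {j, j + 1}" if "i \<noteq> j" "even i \<longleftrightarrow> even j" for i j :: nat
    using that by (auto simp: disjnt_def)
  have matching: "gossip_constraint {{i, i + 1} | i. P i}"
    if "\<And>i j. P i \<Longrightarrow> P j \<Longrightarrow> even i \<longleftrightarrow> even j" for P :: "nat \<Rightarrow> bool"
    unfolding gossip_constraint_def
  proof (rule pairwiseI)
    fix e f assume "e \<in> {{i, i + 1} | i. P i}" "f \<in> {{i, i + 1} | i. P i}" "e \<noteq> f"
    then obtain i j where ij: "P i" "P j" "e = {i, i + 1}" "f = {j, j + 1}" "i \<noteq> j" by blast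
    show "disjnt e f"
      unfolding ij(3,4) by (rule step[OF \<open>i \<noteq> j\<close> that[OF \<open>P i\<close> \<open>P j\<close>]])
  qed
  have gossip: "gossip_constraint O1" "gossip_constraint E" "gossip_constraint L"
    using matching[of "\<lambda>i. i < m \<and> odd i"] matching[of "\<lambda>i. 1 \<le> i \<and> i < m \<and> even i"]
    unfolding O1_def E_def by (blast, blast, simp add: L_def gossip_constraint_def)
  have odd_pos': "1 \<le> i" if "odd i" for i :: nat
    using odd_pos[OF that] by simp
  have "O1 \<union> E = {{i, i + 1} | i. 1 \<le> i \<and> i < m}"
    unfolding O1_def E_def using odd_pos' by blast
  moreover have "i < m \<longleftrightarrow> i \<le> m - 1" for i
    using m by auto
  ultimately have union: "O1 \<union> (E \<union> L) = ring_edges m"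
    unfolding ring_edges_def L_def by (simp add: Un_assoc[symmetric])
  have "disjoint {O1, E, L}"
    using dis by (auto simp: pairwise_insert intro: disjnt_sym)
  moreover have "distinct [O1, E, L]"
    using dis ne by (auto simp: disjnt_def)
  ultimately have "gossip_partition m [O1, E, L]"
    using ne union gossip unfolding gossip_partition_def partition_on_def by auto
  then show ?thesis ..
qed

section \<open>Executing rounds\<close>

lemma agree_on_agents_trans:
  "agree_on_agents m s t \<Longrightarrow> agree_on_agents m t u \<Longrightarrow> agree_on_agents m s u"
  by (simp add: agree_on_agents_def)

text \<open>States are compared on agents only, since other values are arbitrary; \<open>Pre\<close>
  and \<open>Post\<close> never leave the agents, so such values cannot leak in.\<close>

lemma perform_cong:
  assumes "agree_on_agents m s t"
  shows "agree_on_agents m (perform m act s) (perform m act t)"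
  using assms Pre_in_agents[of _ m] Post_in_agents[of _ m]
  by (cases act) (auto simp: agree_on_agents_def activate_def local_update_def split: prod.splits)

lemma execute_cong:
  "agree_on_agents m s t \<Longrightarrow> agree_on_agents m (execute m acts s) (execute m acts t)"
  unfolding execute_def by (induction acts arbitrary: s t) (simp_all add: perform_cong)

text \<open>The right-hand sides use the initial \<open>a\<close> and \<open>b\<close>: an edge
  reads and writes only its own two estimates, and it lies in at most one class, so these are still
  untouched when its round comes.\<close>

lemma execute_rounds:
  assumes "distinct Cs" "pairwise disjnt (set Cs)" "i \<in> {1..m}"
  shows "fst (execute m (map (Round k) Cs) (a, b)) i =
      (if {Pre m i, i} \<in> \<Union>(set Cs) then (1 - alpha m k) * a i + alpha m k * b (Pre m i) else a i)
    \<and> snd (execute m (map (Round k) Cs) (a, b)) i =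
      (if {i, Post m i} \<in> \<Union>(set Cs) then (1 - alpha m k) * b i + alpha m k * a (Post m i) else b i)"
  using assms
proof (induction Cs arbitrary: i rule: rev_induct)
  case Nil
  then show ?case by (simp add: execute_def)
next
  case (snoc C Cs)
  obtain a' b' where s: "execute m (map (Round k) Cs) (a, b) = (a', b')" by fastforce
  have step: "execute m (map (Round k) (Cs @ [C])) (a, b) = activate m k C (a', b')"
    using s by (simp add: execute_def)
  \<comment> \<open>Needed for every agent \<open>j\<close>, because the last round also reads the
    estimates of both neighbours of \<open>i\<close>.\<close>
  have IH: "a' j = (if {Pre m j, j} \<in> \<Union>(set Cs)
        then (1 - alpha m k) * a j + alpha m k * b (Pre m j) else a j)"
    "b' j = (if {j, Post m j} \<in> \<Union>(set Cs)
        then (1 - alpha m k) * b j + alpha m k * a (Post m j) else b j)"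
    if "j \<in> {1..m}" for j
    using snoc.IH[OF _ _ that] snoc.prems s by (auto simp: pairwise_insert)
  \<comment> \<open>An edge active in the last round was not active before, so both estimates it
    reads are the initial ones.\<close>
  have disj: "e \<notin> \<Union>(set Cs)" if "e \<in> C" for e
    using snoc.prems that unfolding pairwise_def disjnt_def by fastforce
  show ?case
    using IH[OF \<open>i \<in> {1..m}\<close>] IH[OF Pre_in_agents[OF \<open>i \<in> {1..m}\<close>]]
      IH[OF Post_in_agents[OF \<open>i \<in> {1..m}\<close>]] disj[of "{Pre m i, i}"] disj[of "{i, Post m i}"]
    unfolding step by (simp add: activate_def Post_Pre[OF \<open>i \<in> {1..m}\<close>] Pre_Post[OF \<open>i \<in> {1..m}\<close>])
qed

text \<open>The classes cover the ring, so every estimate is served by some round.\<close>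

lemma execute_exchange:
  assumes "gossip_partition m Cs" "i \<in> {1..m}"
  shows "fst (execute m (map (Round k) Cs) (a, b)) i = (1 - alpha m k) * a i + alpha m k * b (Pre m i)"
    and "snd (execute m (map (Round k) Cs) (a, b)) i = (1 - alpha m k) * b i + alpha m k * a (Post m i)"
proof -
  have "distinct Cs" "pairwise disjnt (set Cs)" "\<Union>(set Cs) = ring_edges m"
    using assms(1) unfolding gossip_partition_def partition_on_def disjoint_def
      pairwise_def disjnt_def by auto
  then show
    "fst (execute m (map (Round k) Cs) (a, b)) i = (1 - alpha m k) * a i + alpha m k * b (Pre m i)"
    "snd (execute m (map (Round k) Cs) (a, b)) i = (1 - alpha m k) * b i + alpha m k * a (Post m i)"
    using execute_rounds[of Cs i m k a b] Pre_edge Post_edge assms(2) by auto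
qed

section \<open>The complete schedule\<close>

lemma schedule_1: "schedule Cs (Suc 0) = []"
  by (simp add: schedule_def)

lemma schedule_Suc:
  "K \<ge> 1 \<Longrightarrow> schedule Cs (Suc K) = schedule Cs K @ iteration_actions Cs (Suc K)"
  by (simp add: schedule_def)

lemma num_rounds_schedule:
  assumes "length Cs = 3"
  shows "num_rounds (schedule Cs (2 * n + 1)) = 3 * n"
proof (induction n)
  case 0
  then show ?case by (simp add: schedule_1 num_rounds_def)
next
  \<comment> \<open>Two more iterations are appended: an exchange with one round per class, and a
    local one with none.\<close>
  case (Suc n)
  have "filter is_Round (map (Round k) Cs) = map (Round k) Cs" for k
    by (simp add: filter_map comp_def)
  then show ?case
    using Suc assms by (simp add: schedule_Suc num_rounds_def iteration_actions_def)
qed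

lemma gossip_compliant_schedule:
  assumes "gossip_partition m Cs"
  shows "gossip_compliant m (schedule Cs K)"
proof -
  have "C \<in> set Cs" if "Round k C \<in> set (schedule Cs K)" for k C
    using that by (auto simp: schedule_def iteration_actions_def split: if_splits)
  moreover have "C \<subseteq> ring_edges m \<and> gossip_constraint C" if "C \<in> set Cs" for C
    using assms that unfolding gossip_partition_def partition_on_def by auto
  ultimately show ?thesis unfolding gossip_compliant_def by blast
qed

theorem mainTheorem2:
  fixes n m :: nat
    and x0 :: "nat \<Rightarrow> real"
    and xa xb :: "nat \<Rightarrow> nat \<Rightarrow> real"
  assumes "n \<ge> 1" and "m = 2 * n + 1"
    and "\<forall>i\<in>{1..m}. xa i 1 = x0 i \<and> xb i 1 = x0 i"
    and "\<forall>k\<in>{2..m}. even k \<longrightarrow> (\<forall>i\<in>{1..m}.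
           xa i k = (1 - alpha m k) * xa i (k - 1) + alpha m k * xb (Pre m i) (k - 1) \<and>
           xb i k = (1 - alpha m k) * xb i (k - 1) + alpha m k * xa (Post m i) (k - 1))"
    and "\<forall>k\<in>{2..m}. odd k \<longrightarrow> (\<forall>i\<in>{1..m}.
           xa i k = (1 - alpha m k) * xa i (k - 1) + alpha m k * xb i (k - 1) \<and>
           xb i k = (1 - alpha m k) * xb i (k - 1) + alpha m k * xa i (k - 1))"
  shows "(\<forall>i\<in>{1..m}. xa i m = (1 / real m) * (\<Sum>j=1..m. x0 j)) \<and>
    card {k\<in>{2..m}. even k} = n \<and>
    (\<exists>Cs. gossip_partition m Cs) \<and>
    (\<forall>Cs. gossip_partition m Cs \<longrightarrow>
       (\<forall>k\<in>{2..m}. even k \<longrightarrow>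
          agree_on_agents m
            (execute m (map (Round k) Cs) (\<lambda>i. xa i (k - 1), \<lambda>i. xb i (k - 1)))
            (\<lambda>i. xa i k, \<lambda>i. xb i k)) \<and>
       gossip_compliant m (schedule Cs m) \<and>
       num_rounds (schedule Cs m) = 3 * n \<and>
       (\<forall>K\<in>{1..m}.
          agree_on_agents m (execute m (schedule Cs K) (x0, x0)) (\<lambda>i. xa i K, \<lambda>i. xb i K)))"
proof -
  have exchange: "agree_on_agents m (execute m (map (Round k) Cs) (\<lambda>i. xa i (k - 1), \<lambda>i. xb i (k - 1)))
      (\<lambda>i. xa i k, \<lambda>i. xb i k)"
    if "gossip_partition m Cs" "k \<in> {2..m}" "even k" for Cs k
    using assms(4) execute_exchange[OF that(1)] that by (auto simp: agree_on_agents_def)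
  have iteration: "agree_on_agents m
      (execute m (iteration_actions Cs k) (\<lambda>i. xa i (k - 1), \<lambda>i. xb i (k - 1)))
      (\<lambda>i. xa i k, \<lambda>i. xb i k)"
    if "gossip_partition m Cs" "k \<in> {2..m}" for Cs k
  proof (cases "even k")
    case True
    then show ?thesis using exchange that by (simp add: iteration_actions_def)
  next
    case False
    then show ?thesis
      using assms(5) that
      by (auto simp: iteration_actions_def agree_on_agents_def execute_def local_update_def)
  qed
  \<comment> \<open>Induction on \<open>K\<close> from the empty schedule at \<open>K = 1\<close>.
    The state reached so far is known only on the agents, so congruence first replaces it by the
    given estimates, and then one iteration is appended.\<close>
  have run: "agree_on_agents m (execute m (schedule Cs K) (x0, x0)) (\<lambda>i. xa i K, \<lambda>i. xb i K)"
    if part: "gossip_partition m Cs" and "1 \<le> K" "K \<le> m" for Cs K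
    using that(2,3)
  proof (induction K rule: dec_induct)
    case base
    then show ?case using assms(3) by (simp add: agree_on_agents_def schedule_1 execute_def)
  next
    case (step K)
    let ?acts = "iteration_actions Cs (Suc K)"
    have eq: "execute m (schedule Cs (Suc K)) (x0, x0)
        = execute m ?acts (execute m (schedule Cs K) (x0, x0))"
      using step by (simp add: schedule_Suc execute_def)
    have trans1: "agree_on_agents m (execute m ?acts (execute m (schedule Cs K) (x0, x0)))
        (execute m ?acts (\<lambda>i. xa i K, \<lambda>i. xb i K))"
      using step.IH step.hyps step.prems by (intro execute_cong) simp
    have trans2: "agree_on_agents m (execute m ?acts (\<lambda>i. xa i K, \<lambda>i. xb i K))
        (\<lambda>i. xa i (Suc K), \<lambda>i. xb i (Suc K))"
      using iteration[OF part, of "Suc K"] step by simp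
    show ?case unfolding eq using agree_on_agents_trans[OF trans1 trans2] .
  qed
  show ?thesis
  proof (intro conjI allI impI ballI)
    show "card {k\<in>{2..m}. even k} = n"
      using card_even_iterations assms(2) by simp
    show "num_rounds (schedule Cs m) = 3 * n" if "gossip_partition m Cs" for Cs
      using num_rounds_schedule that assms(2) by (simp add: gossip_partition_def)
    show "agree_on_agents m (execute m (schedule Cs K) (x0, x0)) (\<lambda>i. xa i K, \<lambda>i. xb i K)"
      if "gossip_partition m Cs" "K \<in> {1..m}" for Cs K
      using run that by simp
  qed (fact average_reached[OF assms] gossip_partition_exists[OF assms(1,2)] exchange
      gossip_compliant_schedule)+
qed

end
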